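(* Let $N_A$ be a seminorm on $\mathbb{B}_A(\mathcal{H})$ and let $T\in\mathbb{B}_A(\mathcal{H})$. Then $$\omega_{N_A}(T)\le\sqrt{N_A^2\big(\Re_A(T)\big)+N_A^2\big(\Im_A(T)\big)}.$$
   Context: $\mathcal{H}$ is a complex Hilbert space with inner product $\langle\cdot,\cdot\rangle$, $\mathbb{B}(\mathcal{H})$ is the algebra of bounded linear operators on $\mathcal{H}$, and $A\in\mathbb{B}(\mathcal{H})$ is a non-zero positive operator ($\langle Ax,x\rangle\ge 0$ for all $x$). $\mathbb{B}_A(\mathcal{H})$ is the set of $T\in\mathbb{B}(\mathcal{H})$ with $\mathcal{R}(T^*A)\subseteq\mathcal{R}(A)$ ($\mathcal{R}$ denotes range); it is a subalgebra of $\mathbb{B}(\mathcal{H})$. For $T\in\mathbb{B}_A(\mathcal{H})$, $T^{\sharp_A}$ is the unique $X\in\mathbb{B}(\mathcal{H})$ with $AX=T^*A$ and $\mathcal{R}(X)\subseteq\overline{\mathcal{R}(A)}$; one has $T^{\sharp_A}\in\mathbb{B}_A(\mathcal{H})$. Put $\Re_A(T)=\frac{T+T^{\sharp_A}}{2}$ and $\Im_A(T)=\frac{T-T^{\sharp_A}}{2i}$. For a seminorm $N_A$ on $\mathbb{B}_A(\mathcal{H})$, the generalized $A$-numerical radius is $\omega_{N_A}(T)=\sup_{\theta\in\mathbb{R}}N_A\big(\Re_A(e^{i\theta}T)\big)$ for $T\in\mathbb{B}_A(\mathcal{H})$; $N_A^2(T)$ means $(N_A(T))^2$. *)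

theory Defs
  imports "HOL-Analysis.Analysis"
begin

class complex_inner = real_normed_vector +
  fixes scaleC :: "complex \<Rightarrow> 'a \<Rightarrow> 'a" (infixr "*\<^sub>C" 75)
    and cinner :: "'a \<Rightarrow> 'a \<Rightarrow> complex"
  assumes scaleR_scaleC: "r *\<^sub>R x = complex_of_real r *\<^sub>C x"
    and scaleC_add_right: "a *\<^sub>C (x + y) = a *\<^sub>C x + a *\<^sub>C y"
    and scaleC_add_left: "(a + b) *\<^sub>C x = a *\<^sub>C x + b *\<^sub>C x"
    and scaleC_scaleC: "a *\<^sub>C b *\<^sub>C x = (a * b) *\<^sub>C x"
    and cinner_commute: "cinner x y = cnj (cinner y x)"
    and cinner_add_left: "cinner (x + y) z = cinner x z + cinner y z"
    and cinner_scaleC_left: "cinner (a *\<^sub>C x) y = a * cinner x y"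
    \<comment> \<open>The norm of the type is the one induced by the inner product; together with the norm
      axioms this also gives positivity and definiteness of the inner product.\<close>
    and cinner_self: "cinner x x = complex_of_real ((norm x)\<^sup>2)"

class chilbert_space = complex_inner + banach

instantiation complex :: chilbert_space
begin

definition scaleC_complex :: "complex \<Rightarrow> complex \<Rightarrow> complex"
  where "scaleC_complex a x = a * x"

definition cinner_complex :: "complex \<Rightarrow> complex \<Rightarrow> complex"
  where "cinner_complex x y = x * cnj y"

instance
proof
  fix x :: complex
  show "cinner x x = complex_of_real ((norm x)\<^sup>2)"
    by (simp only: cinner_complex_def complex_norm_square)
qed (simp_all add: scaleC_complex_def cinner_complex_def scaleR_conv_of_real algebra_simps)

end

definition bounded_clinear :: "('a::complex_inner \<Rightarrow> 'b::complex_inner) \<Rightarrow> bool"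
  where "bounded_clinear T \<longleftrightarrow> bounded_linear T \<and> (\<forall>c x. T (c *\<^sub>C x) = c *\<^sub>C T x)"

definition positive_op :: "('a::complex_inner \<Rightarrow> 'a) \<Rightarrow> bool"
  where "positive_op A \<longleftrightarrow> bounded_clinear A \<and> (\<forall>x. cinner (A x) x \<in> \<real>\<^sub>\<ge>\<^sub>0)"

text \<open>On a Hilbert space the adjoint of a bounded operator exists and is unique (Riesz).\<close>

definition cadjoint :: "('a::chilbert_space \<Rightarrow> 'a) \<Rightarrow> 'a \<Rightarrow> 'a"
  where "cadjoint T = (THE S. bounded_clinear S \<and> (\<forall>x y. cinner (T x) y = cinner x (S y)))"

definition B_A :: "('a::chilbert_space \<Rightarrow> 'a) \<Rightarrow> ('a \<Rightarrow> 'a) set"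
  where "B_A A = {T. bounded_clinear T \<and> range (cadjoint T \<circ> A) \<subseteq> range A}"

text \<open>For positive \<open>A\<close> and \<open>T \<in> B_A A\<close> the operator described below exists and is unique
  (Douglas' range inclusion theorem).\<close>

definition sharp :: "('a::chilbert_space \<Rightarrow> 'a) \<Rightarrow> ('a \<Rightarrow> 'a) \<Rightarrow> 'a \<Rightarrow> 'a"
  where "sharp A T =
    (THE X. bounded_clinear X \<and> A \<circ> X = cadjoint T \<circ> A \<and> range X \<subseteq> closure (range A))"

definition Re_A :: "('a::chilbert_space \<Rightarrow> 'a) \<Rightarrow> ('a \<Rightarrow> 'a) \<Rightarrow> 'a \<Rightarrow> 'a"
  where "Re_A A T = (\<lambda>x. (1 / 2) *\<^sub>C (T x + sharp A T x))"

definition Im_A :: "('a::chilbert_space \<Rightarrow> 'a) \<Rightarrow> ('a \<Rightarrow> 'a) \<Rightarrow> 'a \<Rightarrow> 'a"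
  where "Im_A A T = (\<lambda>x. (1 / (2 * \<i>)) *\<^sub>C (T x - sharp A T x))"

text \<open>Only the values of \<open>N\<close> on \<open>B_A A\<close> matter.\<close>

definition seminorm_B_A :: "('a::chilbert_space \<Rightarrow> 'a) \<Rightarrow> (('a \<Rightarrow> 'a) \<Rightarrow> real) \<Rightarrow> bool"
  where "seminorm_B_A A N \<longleftrightarrow>
    (\<forall>T\<in>B_A A. 0 \<le> N T) \<and>
    (\<forall>T\<in>B_A A. \<forall>c. N (\<lambda>x. c *\<^sub>C T x) = cmod c * N T) \<and>
    (\<forall>S\<in>B_A A. \<forall>T\<in>B_A A. N (\<lambda>x. S x + T x) \<le> N S + N T)"

text \<open>For a seminorm \<open>N\<close> and \<open>T \<in> B_A A\<close> the supremum is over a set bounded by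
  \<open>(N T + N (sharp A T)) / 2\<close>, so the real-valued supremum is the intended one.\<close>

definition gen_numerical_radius ::
    "('a::chilbert_space \<Rightarrow> 'a) \<Rightarrow> (('a \<Rightarrow> 'a) \<Rightarrow> real) \<Rightarrow> ('a \<Rightarrow> 'a) \<Rightarrow> real"
  where "gen_numerical_radius A N T =
    (SUP \<theta>::real. N (Re_A A (\<lambda>x. exp (\<i> * complex_of_real \<theta>) *\<^sub>C T x)))"

end

theory Submission
  imports Defs
begin

text \<open>
  Why the bound holds: since \<open>T \<mapsto> T\<^sup>\<sharp>\<close> is conjugate-linear, Euler's formula gives
  \<open>\<Re>\<^sub>A (exp (\<i> \<theta>) T) = cos \<theta> \<Re>\<^sub>A T - sin \<theta> \<Im>\<^sub>A T\<close> (lemma \<open>Re_A_rotate\<close>). The seminorm of the right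
  side is at most \<open>\<bar>cos \<theta>\<bar> N (\<Re>\<^sub>A T) + \<bar>sin \<theta>\<bar> N (\<Im>\<^sub>A T)\<close>, and the Cauchy-Schwarz inequality in the
  plane bounds this by the square root, uniformly in \<open>\<theta>\<close>.

  The seminorm axioms speak about members of \<open>B_A A\<close> only, so \<open>\<Re>\<^sub>A T\<close> and \<open>\<Im>\<^sub>A T\<close> have to be shown
  to lie there, and conjugate-linearity of the sharp operation requires that \<open>T\<^sup>\<sharp>\<close>, which is a
  definite description, really exists and is unique. Most of the work goes into this. Adjoints come
  from the Riesz representation, which rests on orthogonal projection onto closed subspaces. For
  \<open>T\<^sup>\<sharp>\<close> one solves \<open>A X = T\<^sup>* A\<close> pointwise; the solution in the closure of the range of \<open>A\<close> exists by
  projecting an arbitrary one, because the orthogonal complement of that closure lies in the kernel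
  of \<open>A\<close>, and it is unique because \<open>A\<close> is injective on that closure. Hence \<open>X\<close> is linear.
  It is bounded by the Baire category theorem (\<open>reduced_solution_exists\<close>). Taking
  adjoints in \<open>A X = T\<^sup>* A\<close> gives \<open>X\<^sup>* A = A T\<close>, so \<open>T\<^sup>\<sharp>\<close> belongs to \<open>B_A A\<close> as well.
\<close>

section \<open>Elementary properties of the inner product\<close>

lemma scaleC_zero_left: "0 *\<^sub>C (x::'a::complex_inner) = 0"
  using scaleR_scaleC[of 0 x] by simp

lemma scaleC_zero_right: "c *\<^sub>C (0::'a::complex_inner) = 0"
  using scaleC_add_right[of c 0 "0::'a"] by simp

lemma scaleC_minus_right: "c *\<^sub>C (- x) = - (c *\<^sub>C (x::'a::complex_inner))"
  using scaleC_add_right[of c x "- x"] by (simp add: scaleC_zero_right eq_neg_iff_add_eq_0 add.commute)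

lemma scaleC_diff_right: "c *\<^sub>C (x - y) = c *\<^sub>C x - c *\<^sub>C (y::'a::complex_inner)"
  using scaleC_add_right[of c x "- y"] by (simp add: scaleC_minus_right)

lemma scaleC_minus1: "(- 1) *\<^sub>C (x::'a::complex_inner) = - x"
  using scaleR_scaleC[of "- 1" x] by simp

lemma scaleC_minus_left: "(- c) *\<^sub>C x = - (c *\<^sub>C (x::'a::complex_inner))"
  using scaleC_scaleC[of "- 1" c x] by (simp add: scaleC_minus1)

lemma cinner_add_right: "cinner x (y + z) = cinner x y + cinner (x::'a::complex_inner) z"
  by (subst (1 2 3) cinner_commute) (simp add: cinner_add_left)

lemma cinner_scaleC_right: "cinner x (c *\<^sub>C y) = cnj c * cinner (x::'a::complex_inner) y"
  by (subst (1 2) cinner_commute) (simp add: cinner_scaleC_left)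

lemma cinner_minus_left: "cinner (- x) y = - cinner (x::'a::complex_inner) y"
  using cinner_scaleC_left[of "- 1" x y] by (simp add: scaleC_minus1)

lemma cinner_minus_right: "cinner x (- y) = - cinner (x::'a::complex_inner) y"
  using cinner_scaleC_right[of x "- 1" y] by (simp add: scaleC_minus1)

lemma cinner_diff_left: "cinner (x - y) z = cinner x z - cinner (y::'a::complex_inner) z"
  using cinner_add_left[of x "- y" z] by (simp add: cinner_minus_left)

lemma cinner_diff_right: "cinner x (y - z) = cinner x y - cinner (x::'a::complex_inner) z"
  using cinner_add_right[of x y "- z"] by (simp add: cinner_minus_right)

lemma cinner_zero_left: "cinner 0 (x::'a::complex_inner) = 0"
  using cinner_diff_left[of 0 0 x] by simp

lemma cinner_zero_right: "cinner (x::'a::complex_inner) 0 = 0"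
  using cinner_diff_right[of x 0 0] by simp

lemma norm_scaleC: "norm (c *\<^sub>C (x::'a::complex_inner)) = cmod c * norm x"
proof -
  have "complex_of_real ((norm (c *\<^sub>C x))\<^sup>2) = c * cnj c * cinner x x"
    unfolding cinner_self[symmetric] by (simp add: cinner_scaleC_left cinner_scaleC_right)
  also have "\<dots> = complex_of_real ((cmod c * norm x)\<^sup>2)"
    by (simp add: cinner_self complex_norm_square[symmetric] power_mult_distrib)
  finally have "(norm (c *\<^sub>C x))\<^sup>2 = (cmod c * norm x)\<^sup>2"
    using of_real_eq_iff by blast
  then show ?thesis by simp
qed

lemma cinner_ext:
  assumes "\<And>z. cinner z x = cinner z (y::'a::complex_inner)"
  shows "x = y"
proof -
  have "cinner (x - y) (x - y) = 0"
    using assms by (simp add: cinner_diff_right)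
  then show ?thesis by (simp add: cinner_self)
qed

text \<open>
  Pythagoras for the splitting of \<open>x\<close> into its component along \<open>y\<close> and the rest. Nonnegativity of
  the left side is the Cauchy-Schwarz inequality; and if subtracting a multiple of \<open>y\<close> never makes
  \<open>x\<close> shorter, then \<open>x\<close> must be orthogonal to \<open>y\<close>, which is how nearest points become projections.
\<close>

lemma norm_sq_component_removed:
  fixes x y :: "'a::complex_inner"
  assumes "y \<noteq> 0"
  shows "(norm (x - (cinner x y / complex_of_real ((norm y)\<^sup>2)) *\<^sub>C y))\<^sup>2
    = (norm x)\<^sup>2 - (cmod (cinner x y))\<^sup>2 / (norm y)\<^sup>2"
proof -
  define r where "r = complex_of_real ((norm y)\<^sup>2)"
  define c where "c = cinner x y / r"
  have r: "r \<noteq> 0" "cnj r = r" "cinner y y = r"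
    using assms by (auto simp: r_def cinner_self)
  have "complex_of_real ((norm (x - c *\<^sub>C y))\<^sup>2)
      = cinner x x - cnj c * cinner x y - c * cinner y x + c * cnj c * r"
    unfolding cinner_self[symmetric]
    by (simp add: cinner_diff_left cinner_diff_right cinner_scaleC_left cinner_scaleC_right r algebra_simps)
  also have "\<dots> = cinner x x - cinner x y * cnj (cinner x y) / r"
    using r by (simp add: c_def field_simps cinner_commute[of y x])
  also have "\<dots> = complex_of_real ((norm x)\<^sup>2 - (cmod (cinner x y))\<^sup>2 / (norm y)\<^sup>2)"
    by (simp add: cinner_self complex_norm_square[symmetric] r_def)
  finally show ?thesis unfolding c_def r_def using of_real_eq_iff by blast
qed

lemma Cauchy_Schwarz_cinner: "cmod (cinner x y) \<le> norm x * norm (y::'a::complex_inner)"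
proof (cases "y = 0")
  case False
  have "0 \<le> (norm x)\<^sup>2 - (cmod (cinner x y))\<^sup>2 / (norm y)\<^sup>2"
    using norm_sq_component_removed[OF False, of x] by (metis zero_le_power2)
  then have "(cmod (cinner x y))\<^sup>2 \<le> (norm x * norm y)\<^sup>2"
    using False by (simp add: field_simps)
  then show ?thesis by (simp add: power2_le_iff_abs_le)
qed (simp add: cinner_zero_right)

lemma bounded_linear_cinner_left: "bounded_linear (\<lambda>x. cinner x (y::'a::complex_inner))"
  by (rule bounded_linear_intro[where K = "norm y"])
    (simp_all add: cinner_add_left scaleR_scaleC cinner_scaleC_left scaleC_complex_def
      Cauchy_Schwarz_cinner)

lemma bounded_linear_cinner_right: "bounded_linear (\<lambda>y. cinner (x::'a::complex_inner) y)"
proof (rule bounded_linear_intro[where K = "norm x"])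
  show "cmod (cinner x y) \<le> norm y * norm x" for y
    using Cauchy_Schwarz_cinner[of x y] by (simp add: mult.commute)
qed (simp_all add: cinner_add_right scaleR_scaleC cinner_scaleC_right scaleC_complex_def)

lemma parallelogram_law:
  fixes x y :: "'a::complex_inner"
  shows "(norm (x + y))\<^sup>2 + (norm (x - y))\<^sup>2 = 2 * (norm x)\<^sup>2 + 2 * (norm y)\<^sup>2"
proof -
  have "complex_of_real ((norm (x + y))\<^sup>2 + (norm (x - y))\<^sup>2)
      = complex_of_real (2 * (norm x)\<^sup>2 + 2 * (norm y)\<^sup>2)"
    unfolding of_real_add of_real_mult cinner_self[symmetric]
    by (simp add: cinner_add_left cinner_add_right cinner_diff_left cinner_diff_right)
  then show ?thesis using of_real_eq_iff by blast
qed

section \<open>Orthogonal projection and the Riesz representation\<close>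

definition csubspace :: "'a::complex_inner set \<Rightarrow> bool"
  where "csubspace M \<longleftrightarrow> 0 \<in> M \<and> (\<forall>x\<in>M. \<forall>y\<in>M. x + y \<in> M) \<and> (\<forall>c. \<forall>x\<in>M. c *\<^sub>C x \<in> M)"

lemma csubspace_diff: "csubspace M \<Longrightarrow> x \<in> M \<Longrightarrow> y \<in> M \<Longrightarrow> x - y \<in> M"
  unfolding csubspace_def by (metis diff_conv_add_uminus scaleC_minus1)

lemma csubspace_lincomb: "csubspace M \<Longrightarrow> x \<in> M \<Longrightarrow> y \<in> M \<Longrightarrow> a *\<^sub>C x + b *\<^sub>C y \<in> M"
  by (simp add: csubspace_def)

text \<open>
  By the parallelogram law two almost-nearest points are close to each other, since their midpoint
  lies in \<open>M\<close> and so cannot be much nearer to \<open>x\<close> than they are. The sets of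
  almost-nearest points are therefore closed, nested and of diameter tending to zero, and
  completeness gives a common point.
\<close>

lemma nearest_point_exists:
  fixes M :: "'a::chilbert_space set"
  assumes M: "csubspace M" and cl: "closed M"
  obtains p where "p \<in> M" "\<And>m. m \<in> M \<Longrightarrow> norm (x - p) \<le> norm (x - m)"
proof -
  define D where "D = (INF m\<in>M. (norm (x - m))\<^sup>2)"
  define S where "S n = {m\<in>M. (norm (x - m))\<^sup>2 \<le> D + 1 / (real n + 1)}" for n :: nat
  have ne: "M \<noteq> {}" using M by (auto simp: csubspace_def)
  have bdd: "bdd_below ((\<lambda>m. (norm (x - m))\<^sup>2) ` M)"
    by (rule bdd_belowI[of _ 0]) auto
  have D: "D \<le> (norm (x - m))\<^sup>2" if "m \<in> M" for m
    unfolding D_def by (rule cINF_lower[OF bdd that])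
  have diam: "(dist a b)\<^sup>2 \<le> 4 / (real n + 1)" if "a \<in> S n" "b \<in> S n" for a b n
  proof -
    define c where "c = (1/2) *\<^sub>R (a + b)"
    have "c \<in> M"
      using M that unfolding c_def S_def csubspace_def scaleR_scaleC by blast
    have "(x - a) + (x - b) = 2 *\<^sub>R (x - c)"
      by (simp add: c_def algebra_simps scaleR_2)
    then have "(norm ((x - a) + (x - b)))\<^sup>2 = 4 * (norm (x - c))\<^sup>2"
      by (simp add: power_mult_distrib)
    moreover have "norm ((x - a) - (x - b)) = dist a b"
      by (simp add: dist_norm norm_minus_commute)
    ultimately have "4 * (norm (x - c))\<^sup>2 + (dist a b)\<^sup>2
        = 2 * (norm (x - a))\<^sup>2 + 2 * (norm (x - b))\<^sup>2"
      using parallelogram_law[of "x - a" "x - b"] by simp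
    then show ?thesis
      using D[OF \<open>c \<in> M\<close>] that by (simp add: S_def)
  qed
  obtain p where p: "\<And>n. p \<in> S n"
  proof (rule decreasing_closed_nest[of S])
    show "closed (S n)" for n
      unfolding S_def
      unfolding Collect_conj_eq Collect_mem_eq
      by (intro closed_Int cl closed_Collect_le continuous_intros)
    show "S n \<noteq> {}" for n
    proof -
      have "\<exists>m\<in>M. (norm (x - m))\<^sup>2 < D + 1 / (real n + 1)"
        using cINF_less_iff[OF ne bdd, of "D + 1 / (real n + 1)"] by (simp add: D_def)
      then show ?thesis by (force simp: S_def)
    qed
    show "S n \<subseteq> S m" if "m \<le> n" for m n
    proof -
      have "1 / (real n + 1) \<le> 1 / (real m + 1)"
        using that by (simp add: frac_le)
      then show ?thesis by (auto simp: S_def)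
    qed
    show "\<exists>n. \<forall>a\<in>S n. \<forall>b\<in>S n. dist a b < e" if "e > 0" for e
    proof -
      obtain n :: nat where n: "4 / e\<^sup>2 < real n" using reals_Archimedean2 by blast
      have "4 / (real n + 1) < e\<^sup>2"
        using n that by (simp add: field_simps) (smt (verit) zero_less_power)
      then show ?thesis
        using diam that by (meson le_less_trans less_imp_le power_less_imp_less_base)
    qed
  qed blast
  have "(norm (x - p))\<^sup>2 \<le> D"
  proof (rule field_le_epsilon)
    fix e :: real assume "e > 0"
    then obtain n :: nat where n: "1 / (real n + 1) < e"
      using nat_approx_posE by (metis of_nat_Suc add.commute)
    then show "(norm (x - p))\<^sup>2 \<le> D + e" using p[of n] by (simp add: S_def)
  qed
  then have "norm (x - p) \<le> norm (x - m)" if "m \<in> M" for m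
    using D[OF that] by (meson norm_ge_zero order_trans power2_le_imp_le)
  moreover have "p \<in> M" using p[of 0] by (simp add: S_def)
  ultimately show ?thesis using that by blast
qed

lemma orthogonal_projection_exists:
  fixes M :: "'a::chilbert_space set"
  assumes M: "csubspace M" and cl: "closed M"
  obtains p where "p \<in> M" "\<And>m. m \<in> M \<Longrightarrow> cinner (x - p) m = 0"
proof -
  obtain p where p: "p \<in> M" "\<And>m. m \<in> M \<Longrightarrow> norm (x - p) \<le> norm (x - m)"
    using nearest_point_exists[OF assms] by blast
  have "cinner (x - p) m = 0" if m: "m \<in> M" for m
  proof (cases "m = 0")
    case False
    define c where "c = cinner (x - p) m / complex_of_real ((norm m)\<^sup>2)"
    have "p + c *\<^sub>C m \<in> M" using M p(1) m by (simp add: csubspace_def)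
    then have "(norm (x - p))\<^sup>2 \<le> (norm (x - p - c *\<^sub>C m))\<^sup>2"
      using p(2) by (metis diff_diff_eq norm_ge_zero power_mono)
    then have "(cmod (cinner (x - p) m))\<^sup>2 / (norm m)\<^sup>2 \<le> 0"
      unfolding c_def norm_sq_component_removed[OF False, of "x - p"] by simp
    then show ?thesis using False by (simp add: divide_le_0_iff)
  qed (simp add: cinner_zero_right)
  then show ?thesis using that p(1) by blast
qed

text \<open>
  If \<open>f\<close> does not vanish, its kernel has a nonzero normal vector \<open>u\<close>, and every \<open>x\<close> differs from a
  multiple of \<open>u\<close> by an element of the kernel. Pairing this decomposition with \<open>u\<close> shows that \<open>f\<close>
  is the inner product with a multiple of \<open>u\<close>.
\<close>

theorem Riesz_representation:
  fixes f :: "'a::chilbert_space \<Rightarrow> complex"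
  assumes f: "bounded_linear f" and fC: "\<And>c x. f (c *\<^sub>C x) = c * f x"
  obtains y where "\<And>x. f x = cinner x y"
proof (cases "\<forall>x. f x = 0")
  case True
  then show ?thesis using that[of 0] by (simp add: cinner_zero_right)
next
  case False
  interpret f: bounded_linear f by (rule f)
  obtain x0 where x0: "f x0 \<noteq> 0" using False by blast
  have sub: "csubspace {x. f x = 0}"
    by (simp add: csubspace_def f.add f.zero fC)
  have cl: "closed {x. f x = 0}"
    using closed_Collect_eq[OF linear_continuous_on[OF f] continuous_on_const] by simp
  obtain p where p: "f p = 0" "\<And>m. f m = 0 \<Longrightarrow> cinner (x0 - p) m = 0"
    by (rule orthogonal_projection_exists[OF sub cl, of x0]) auto
  define u where "u = x0 - p"
  have fu: "f u \<noteq> 0" using x0 p(1) by (simp add: u_def f.diff)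
  then have u: "u \<noteq> 0" using f.zero by auto
  have "f x = cinner x ((cnj (f u) / complex_of_real ((norm u)\<^sup>2)) *\<^sub>C u)" for x
  proof -
    have "f (x - (f x / f u) *\<^sub>C u) = 0" using fu by (simp add: f.diff fC)
    then have "cinner u (x - (f x / f u) *\<^sub>C u) = 0" using p(2) by (simp add: u_def)
    then have "cinner (x - (f x / f u) *\<^sub>C u) u = 0"
      by (metis cinner_commute complex_cnj_zero)
    then have "cinner x u = (f x / f u) * complex_of_real ((norm u)\<^sup>2)"
      by (simp add: cinner_diff_left cinner_scaleC_left cinner_self)
    then show ?thesis using fu u by (simp add: cinner_scaleC_right)
  qed
  then show ?thesis using that by blast
qed

section \<open>Adjoints\<close>

lemma bounded_clinearI:
  assumes "\<And>x y. T (x + y) = T x + T y" and "\<And>c x. T (c *\<^sub>C x) = c *\<^sub>C T x"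
    and "\<And>x. norm (T x) \<le> K * norm x"
  shows "bounded_clinear T"
  unfolding bounded_clinear_def
  using assms by (auto intro!: bounded_linear_intro[where K = K] simp: scaleR_scaleC mult.commute)

lemma
  assumes "bounded_clinear T"
  shows bounded_clinear_add: "T (x + y) = T x + T y"
    and bounded_clinear_scaleC: "T (c *\<^sub>C x) = c *\<^sub>C T x"
    and bounded_clinear_diff: "T (x - y) = T x - T y"
    and bounded_clinear_zero: "T 0 = 0"
    and bounded_clinear_bounded_linear: "bounded_linear T"
  using assms unfolding bounded_clinear_def
  by (auto simp: linear_add linear_diff linear_0 bounded_linear.linear)

lemma bounded_clinear_lincomb:
  assumes "bounded_clinear S" "bounded_clinear T"
  shows "bounded_clinear (\<lambda>x. a *\<^sub>C S x + b *\<^sub>C T x)"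
proof -
  obtain K L where "\<And>x. norm (S x) \<le> norm x * K" "\<And>x. norm (T x) \<le> norm x * L"
    using assms[THEN bounded_clinear_bounded_linear] bounded_linear.bounded by metis
  note KL = this
  show ?thesis
  proof (rule bounded_clinearI[where K = "cmod a * K + cmod b * L"])
    fix x
    have "norm (a *\<^sub>C S x + b *\<^sub>C T x) \<le> cmod a * norm (S x) + cmod b * norm (T x)"
      using norm_triangle_ineq[of "a *\<^sub>C S x" "b *\<^sub>C T x"] by (simp add: norm_scaleC)
    also have "\<dots> \<le> cmod a * (norm x * K) + cmod b * (norm x * L)"
      by (intro add_mono mult_left_mono KL) auto
    finally show "norm (a *\<^sub>C S x + b *\<^sub>C T x) \<le> (cmod a * K + cmod b * L) * norm x"
      by (simp add: algebra_simps)
  qed (simp_all add: bounded_clinear_add[OF assms(1)] bounded_clinear_add[OF assms(2)]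
      bounded_clinear_scaleC[OF assms(1)] bounded_clinear_scaleC[OF assms(2)]
      scaleC_add_right scaleC_scaleC mult.commute)
qed

text \<open>
  Riesz gives a representing vector \<open>S y\<close> of \<open>x \<mapsto> \<langle>T x, y\<rangle>\<close> for each \<open>y\<close>; since such vectors are unique,
  \<open>S\<close> is linear, and testing with \<open>x = S y\<close> bounds it by any bound of \<open>T\<close>.
\<close>

lemma adjoint_exists:
  fixes T :: "'a::chilbert_space \<Rightarrow> 'a"
  assumes T: "bounded_clinear T"
  obtains S where "bounded_clinear S" "\<And>x y. cinner (T x) y = cinner x (S y)"
proof -
  have "\<exists>z. \<forall>x. cinner (T x) y = cinner x z" for y
  proof -
    have "bounded_linear (\<lambda>x. cinner (T x) y)"
      using bounded_linear_compose[OF bounded_linear_cinner_left bounded_clinear_bounded_linear[OF T]]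
      by simp
    then show ?thesis
      using Riesz_representation[of "\<lambda>x. cinner (T x) y"]
      by (metis bounded_clinear_scaleC[OF T] cinner_scaleC_left)
  qed
  then obtain S where S: "\<And>x y. cinner (T x) y = cinner x (S y)" by metis
  obtain K where K: "\<And>x. norm (T x) \<le> norm x * K"
    using bounded_linear.bounded[OF bounded_clinear_bounded_linear[OF T]] by blast
  have "bounded_clinear S"
  proof (rule bounded_clinearI[where K = K])
    show "S (x + y) = S x + S y" for x y
      by (rule cinner_ext) (simp add: S[symmetric] cinner_add_right)
    show "S (c *\<^sub>C x) = c *\<^sub>C S x" for c x
      by (rule cinner_ext) (simp add: S[symmetric] cinner_scaleC_right)
    show "norm (S y) \<le> K * norm y" for y
    proof (cases "S y = 0")
      case True
      have "0 \<le> norm y * K" using K[of y] norm_ge_zero order_trans by blast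
      then show ?thesis using True by (simp add: mult.commute)
    next
      case False
      have "norm (S y) * norm (S y) = cmod (cinner (T (S y)) y)"
        by (simp add: S cinner_self power2_eq_square norm_mult)
      also have "\<dots> \<le> norm (T (S y)) * norm y" by (rule Cauchy_Schwarz_cinner)
      also have "\<dots> \<le> norm (S y) * K * norm y" by (intro mult_right_mono K) auto
      finally show ?thesis using False by (simp add: mult.assoc)
    qed
  qed
  then show ?thesis using that S by blast
qed

lemma cadjoint_eqI:
  assumes "bounded_clinear S" "\<And>x y. cinner (T x) y = cinner x (S y)"
  shows "cadjoint T = S"
  unfolding cadjoint_def
proof (rule the_equality)
  show "S' = S" if "bounded_clinear S' \<and> (\<forall>x y. cinner (T x) y = cinner x (S' y))" for S'
  proof
    show "S' y = S y" for y
      by (rule cinner_ext) (use that assms(2) in simp)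
  qed
qed (simp add: assms)

lemma
  fixes T :: "'a::chilbert_space \<Rightarrow> 'a"
  assumes "bounded_clinear T"
  shows bounded_clinear_cadjoint: "bounded_clinear (cadjoint T)"
    and cinner_cadjoint: "cinner (T x) y = cinner x (cadjoint T y)"
proof -
  obtain S where S: "bounded_clinear S" "\<And>x y. cinner (T x) y = cinner x (S y)"
    using adjoint_exists[OF assms] by blast
  then have "cadjoint T = S" by (rule cadjoint_eqI)
  then show "bounded_clinear (cadjoint T)" "cinner (T x) y = cinner x (cadjoint T y)"
    using S by auto
qed

lemma cadjoint_lincomb:
  assumes "bounded_clinear S" "bounded_clinear T"
  shows "cadjoint (\<lambda>x. a *\<^sub>C S x + b *\<^sub>C T x)
    = (\<lambda>x. cnj a *\<^sub>C cadjoint S x + cnj b *\<^sub>C cadjoint T x)"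
  by (rule cadjoint_eqI)
    (simp_all add: bounded_clinear_lincomb bounded_clinear_cadjoint assms cinner_add_left
      cinner_add_right cinner_scaleC_left cinner_scaleC_right cinner_cadjoint)

text \<open>
  Polarization: the form \<open>\<langle>A z, z\<rangle>\<close> is real, and comparing imaginary parts at \<open>z = x + y\<close> and
  \<open>z = x + \<i> y\<close> gives the imaginary and the real part of the Hermitian symmetry of \<open>\<langle>A x, y\<rangle>\<close>.
\<close>

lemma positive_op_selfadjoint:
  assumes "positive_op A"
  shows "cinner (A x) y = cinner x (A y)"
proof -
  have A: "bounded_clinear A" and re: "Im (cinner (A z) z) = 0" for z
    using assms by (auto simp: positive_op_def complex_nonneg_Reals_iff)
  have "Im (cinner (A x) y) + Im (cinner (A y) x) = 0"
    using re[of "x + y"] re[of x] re[of y]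
    by (simp add: bounded_clinear_add[OF A] cinner_add_left cinner_add_right)
  moreover have "Re (cinner (A y) x) - Re (cinner (A x) y) = 0"
    using re[of "x + \<i> *\<^sub>C y"] re[of x] re[of y]
    by (simp add: bounded_clinear_add[OF A] bounded_clinear_scaleC[OF A] cinner_add_left
        cinner_add_right cinner_scaleC_left cinner_scaleC_right)
  ultimately have "cinner (A x) y = cnj (cinner (A y) x)"
    by (simp add: complex_eq_iff)
  then show ?thesis by (metis cinner_commute)
qed

section \<open>The reduced solution of an operator equation\<close>

text \<open>
  The form in which the Baire category theorem yields boundedness: countably many sublevel sets
  cover the complete space, so one of them contains a ball, and by linearity a bound on one ball is a
  bound everywhere.
\<close>

lemma linear_bounded_if_closed_sublevels:
  fixes f :: "'a::banach \<Rightarrow> 'b::real_normed_vector"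
  assumes lin: "linear f" and cl: "\<And>n::nat. closed {x. norm (f x) \<le> real n}"
  shows "\<exists>K. \<forall>x. norm (f x) \<le> K * norm x"
proof -
  define S where "S n = {x. norm (f x) \<le> real n}" for n :: nat
  have "x \<in> \<Union>(range S)" for x
    using real_arch_simple[of "norm (f x)"] by (auto simp: S_def)
  then have "interior (\<Union>(range S)) = UNIV"
    by (metis UNIV_eq_I interior_UNIV)
  then have "\<exists>n. interior (S n) \<noteq> {}"
    using Baire_category_alt[of "euclidean :: 'a topology" "range S"] cl
    by (auto simp: completely_metrizable_space_euclidean S_def)
  then obtain n a where "a \<in> interior (S n)" by blast
  then obtain r where r: "r > 0" "ball a r \<subseteq> S n"
    using mem_interior by blast
  have "norm (f x) \<le> 4 * real n / r * norm x" for x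
  proof (cases "x = 0")
    case True
    then show ?thesis using lin by (simp add: linear_0)
  next
    case False
    \<comment> \<open>a multiple of \<open>x\<close> of length \<open>r / 2\<close>, so that translating \<open>a\<close> by it stays in the ball\<close>
    define y where "y = (r / (2 * norm x)) *\<^sub>R x"
    have "norm y < r" using False r(1) by (simp add: y_def)
    then have "a + y \<in> S n" "a \<in> S n" using r by (auto simp: dist_norm)
    moreover have "f y = f (a + y) - f a" using lin by (simp add: linear_add)
    ultimately have "norm (f y) \<le> 2 * real n"
      using norm_triangle_ineq4[of "f (a + y)" "f a"] by (simp add: S_def)
    moreover have "norm (f y) = r / (2 * norm x) * norm (f x)"
      using lin r(1) by (simp add: y_def linear_scale)
    ultimately show ?thesis using False r(1) by (simp add: field_simps)
  qed
  then show ?thesis by blast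
qed

lemma csubspace_closure:
  assumes "csubspace M"
  shows "csubspace (closure M)"
  unfolding csubspace_def
proof (intro conjI ballI allI)
  show "0 \<in> closure M" using assms closure_subset by (auto simp: csubspace_def)
next
  fix x y assume "x \<in> closure M" "y \<in> closure M"
  then obtain f g where "\<And>n. f n \<in> M" "f \<longlonglongrightarrow> x" "\<And>n. g n \<in> M" "g \<longlonglongrightarrow> y"
    by (meson closure_sequential)
  then show "x + y \<in> closure M"
    using assms tendsto_add[of f x sequentially g y] unfolding closure_sequential csubspace_def
    by (metis (no_types, lifting))
next
  fix c x assume "x \<in> closure M"
  then obtain f where f: "\<And>n. f n \<in> M" "f \<longlonglongrightarrow> x"
    by (meson closure_sequential)
  have "bounded_linear (\<lambda>x::'a. c *\<^sub>C x)"
    by (rule bounded_linear_intro[where K = "cmod c"])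
      (simp_all add: scaleC_add_right scaleR_scaleC scaleC_scaleC norm_scaleC mult.commute)
  then have "(\<lambda>n. c *\<^sub>C f n) \<longlonglongrightarrow> c *\<^sub>C x"
    using f(2) by (rule bounded_linear.tendsto)
  then show "c *\<^sub>C x \<in> closure M"
    using assms f(1) unfolding closure_sequential csubspace_def by metis
qed

lemma csubspace_range:
  assumes "bounded_clinear A"
  shows "csubspace (range A)"
  unfolding csubspace_def
  by (auto simp flip: bounded_clinear_add[OF assms] bounded_clinear_scaleC[OF assms])
    (metis bounded_clinear_zero[OF assms] rangeI)

text \<open>
  The tested inequality is a closed condition on \<open>w\<close>, so it passes to the closure and may be applied
  to \<open>w = y\<close>. With \<open>C = 0\<close> this says that a vector in the closure of \<open>M\<close> orthogonal to \<open>M\<close> vanishes.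
\<close>

lemma norm_le_if_tested_on_dense:
  fixes y :: "'a::complex_inner"
  assumes y: "y \<in> closure M" and le: "\<And>w. w \<in> M \<Longrightarrow> cmod (cinner y w) \<le> C * norm w"
    and C: "C \<ge> 0"
  shows "norm y \<le> C"
proof -
  have "closed {w. cmod (cinner y w) \<le> C * norm w}"
    by (intro closed_Collect_le continuous_intros linear_continuous_on bounded_linear_cinner_right)
  then have "cmod (cinner y y) \<le> C * norm y"
    using y le closure_minimal[of M "{w. cmod (cinner y w) \<le> C * norm w}"] by blast
  then show ?thesis using C by (cases "y = 0") (auto simp: cinner_self power2_eq_square norm_mult)
qed

lemma selfadjoint_inj_on_closure_range:
  fixes A :: "'a::chilbert_space \<Rightarrow> 'a"
  assumes A: "bounded_clinear A" and sa: "\<And>x y. cinner (A x) y = cinner x (A y)"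
  shows "inj_on A (closure (range A))"
proof (rule inj_onI)
  fix x y assume xy: "x \<in> closure (range A)" "y \<in> closure (range A)" "A x = A y"
  have "A (x - y) = 0" using xy(3) by (simp add: bounded_clinear_diff[OF A])
  then have "cinner (x - y) w = 0" if "w \<in> range A" for w
    using that by (auto simp flip: sa simp: cinner_zero_left)
  moreover have "x - y \<in> closure (range A)"
    using csubspace_diff[OF csubspace_closure[OF csubspace_range[OF A]]] xy by blast
  ultimately have "norm (x - y) \<le> 0"
    by (intro norm_le_if_tested_on_dense[where M = "range A"]) auto
  then show "x = y" by simp
qed

text \<open>
  Project \<open>y\<close> onto the closure of the range: the remainder is orthogonal to the range of the
  self-adjoint \<open>A\<close>, hence is killed by \<open>A\<close>, and the projection has the same image as \<open>y\<close>.
\<close>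

lemma selfadjoint_preimage_in_closure_range:
  fixes A :: "'a::chilbert_space \<Rightarrow> 'a"
  assumes A: "bounded_clinear A" and sa: "\<And>x y. cinner (A x) y = cinner x (A y)"
  shows "\<exists>p\<in>closure (range A). A p = A y"
proof -
  obtain p where p: "p \<in> closure (range A)" "\<And>m. m \<in> closure (range A) \<Longrightarrow> cinner (y - p) m = 0"
    by (rule orthogonal_projection_exists[OF csubspace_closure[OF csubspace_range[OF A]]
        closed_closure, of y]) auto
  have "cinner (A (y - p)) (A (y - p)) = 0"
    unfolding sa by (intro p(2) subsetD[OF closure_subset] rangeI)
  then have "A y = A p" by (simp add: cinner_self bounded_clinear_diff[OF A])
  then show ?thesis using p(1) by auto
qed

text \<open>
  The instance of Douglas' range inclusion theorem in which \<open>A\<close> is self-adjoint. The pointwise solution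
  \<open>X x\<close> in the closure of the range of \<open>A\<close> is unique and so depends linearly on \<open>x\<close>. For boundedness, note that
  \<open>\<langle>X x, A z\<rangle> = \<langle>B x, z\<rangle>\<close> and that the norm of \<open>X x\<close> can be tested against the vectors \<open>A z\<close>, which
  are dense in the space where \<open>X x\<close> lives. The sublevel sets of the norm of \<open>X x\<close> are therefore
  intersections of closed conditions on the bounded operator \<open>B\<close>, and the Baire argument applies.
\<close>

theorem reduced_solution_exists:
  fixes A B :: "'a::chilbert_space \<Rightarrow> 'a"
  assumes A: "bounded_clinear A" and sa: "\<And>x y. cinner (A x) y = cinner x (A y)"
    and B: "bounded_clinear B" and BA: "range B \<subseteq> range A"
  obtains X where "bounded_clinear X" "A \<circ> X = B" "range X \<subseteq> closure (range A)"
proof -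
  let ?R = "closure (range A)"
  have R: "csubspace ?R" by (intro csubspace_closure csubspace_range A)
  have "\<exists>p\<in>?R. A p = B x" for x
  proof -
    obtain y where "B x = A y" using BA by blast
    then show ?thesis using selfadjoint_preimage_in_closure_range[OF A sa, of y] by simp
  qed
  then obtain X where X: "\<And>x. X x \<in> ?R" "\<And>x. A (X x) = B x" by metis
  have eq: "u = X x" if "u \<in> ?R" "A u = B x" for u x
    using inj_onD[OF selfadjoint_inj_on_closure_range[OF A sa]] that X by simp
  have add: "X (x + y) = X x + X y" for x y
  proof (rule eq[symmetric])
    show "X x + X y \<in> ?R" using R X(1) by (simp add: csubspace_def)
  qed (simp add: bounded_clinear_add[OF A] bounded_clinear_add[OF B] X(2))
  have sc: "X (c *\<^sub>C x) = c *\<^sub>C X x" for c x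
  proof (rule eq[symmetric])
    show "c *\<^sub>C X x \<in> ?R" using R X(1) by (simp add: csubspace_def)
  qed (simp add: bounded_clinear_scaleC[OF A] bounded_clinear_scaleC[OF B] X(2))
  have lin: "linear X"
    by (rule linearI) (simp_all add: add sc scaleR_scaleC)
  have sublevel: "{x. norm (X x) \<le> real n}
      = (\<Inter>z. {x. cmod (cinner (B x) z) \<le> real n * norm (A z)})" for n
  proof -
    have XB: "cinner (X x) (A z) = cinner (B x) z" for x z
      by (simp add: X sa[symmetric])
    have "(\<forall>z. cmod (cinner (B x) z) \<le> real n * norm (A z)) \<longleftrightarrow> norm (X x) \<le> real n" for x
    proof
      assume "\<forall>z. cmod (cinner (B x) z) \<le> real n * norm (A z)"
      then show "norm (X x) \<le> real n"
        by (intro norm_le_if_tested_on_dense[OF X(1)]) (auto simp: XB)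
    next
      assume "norm (X x) \<le> real n"
      then show "\<forall>z. cmod (cinner (B x) z) \<le> real n * norm (A z)"
        using Cauchy_Schwarz_cinner[of "X x"] by (metis XB mult_right_mono norm_ge_zero order_trans)
    qed
    then show ?thesis by blast
  qed
  have "closed {x. norm (X x) \<le> real n}" for n
    unfolding sublevel
    by (intro closed_INT ballI closed_Collect_le continuous_intros linear_continuous_on
        bounded_linear_compose[OF bounded_linear_cinner_left] bounded_clinear_bounded_linear[OF B])
  then obtain K where "\<And>x. norm (X x) \<le> K * norm x"
    using linear_bounded_if_closed_sublevels[OF lin] by blast
  then have "bounded_clinear X" by (rule bounded_clinearI[OF add sc])
  then show ?thesis using that X by (metis comp_def ext image_subsetI)
qed

section \<open>The operation \<open>T \<mapsto> T\<^sup>\<sharp>\<close>\<close>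

lemma positive_op_bounded_clinear: "positive_op A \<Longrightarrow> bounded_clinear A"
  by (simp add: positive_op_def)

lemma B_A_bounded_clinear: "T \<in> B_A A \<Longrightarrow> bounded_clinear T"
  by (simp add: B_A_def)

lemma bounded_clinear_compose:
  assumes "bounded_clinear S" "bounded_clinear T"
  shows "bounded_clinear (S \<circ> T)"
  using assms unfolding bounded_clinear_def comp_def by (auto intro: bounded_linear_compose)

lemma sharp_eqI:
  assumes A: "positive_op A" and X: "bounded_clinear X" "A \<circ> X = cadjoint T \<circ> A"
    "range X \<subseteq> closure (range A)"
  shows "sharp A T = X"
  unfolding sharp_def
proof (rule the_equality)
  fix Y assume Y: "bounded_clinear Y \<and> A \<circ> Y = cadjoint T \<circ> A \<and> range Y \<subseteq> closure (range A)"
  show "Y = X"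
  proof
    fix x
    have "A (Y x) = A (X x)" using X(2) Y by (metis comp_apply)
    then show "Y x = X x"
      using inj_onD[OF selfadjoint_inj_on_closure_range[OF positive_op_bounded_clinear[OF A]
            positive_op_selfadjoint[OF A]]] X(3) Y by blast
  qed
qed (intro conjI X)

lemma
  assumes A: "positive_op A" and T: "T \<in> B_A A"
  shows bounded_clinear_sharp: "bounded_clinear (sharp A T)"
    and sharp_eq: "A (sharp A T x) = cadjoint T (A x)"
    and sharp_range: "sharp A T x \<in> closure (range A)"
proof -
  note A' = positive_op_bounded_clinear[OF A]
  obtain X where X: "bounded_clinear X" "A \<circ> X = cadjoint T \<circ> A" "range X \<subseteq> closure (range A)"
    by (rule reduced_solution_exists[OF A' positive_op_selfadjoint[OF A],
        of "cadjoint T \<circ> A"])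
      (use T A' in \<open>auto simp: B_A_def bounded_clinear_compose bounded_clinear_cadjoint\<close>)
  then have "sharp A T = X" using sharp_eqI[OF A] by blast
  moreover have "A (X x) = cadjoint T (A x)" using X(2) by (metis comp_apply)
  ultimately show "bounded_clinear (sharp A T)" "A (sharp A T x) = cadjoint T (A x)"
      "sharp A T x \<in> closure (range A)"
    using X by auto
qed

lemma B_A_lincomb:
  assumes A: "bounded_clinear A" and "S \<in> B_A A" "T \<in> B_A A"
  shows "(\<lambda>x. a *\<^sub>C S x + b *\<^sub>C T x) \<in> B_A A"
proof -
  have ST: "bounded_clinear S" "bounded_clinear T" using assms B_A_bounded_clinear by auto
  have "cadjoint S (A x) \<in> range A" "cadjoint T (A x) \<in> range A" for x
    using assms by (auto simp: B_A_def)
  then have "cnj a *\<^sub>C cadjoint S (A x) + cnj b *\<^sub>C cadjoint T (A x) \<in> range A" for x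
    by (rule csubspace_lincomb[OF csubspace_range[OF A]])
  then show ?thesis
    by (auto simp: B_A_def bounded_clinear_lincomb ST cadjoint_lincomb)
qed

lemma B_A_scaleC:
  assumes "bounded_clinear A" "T \<in> B_A A"
  shows "(\<lambda>x. c *\<^sub>C T x) \<in> B_A A"
  using B_A_lincomb[OF assms(1) assms(2) assms(2), of c 0] by (simp add: scaleC_zero_left)

text \<open>
  Passing to adjoints in the defining equation \<open>A T\<^sup>\<sharp> = T\<^sup>* A\<close> gives \<open>(T\<^sup>\<sharp>)\<^sup>* A = A T\<close>, whose range
  visibly lies in that of \<open>A\<close>.
\<close>

lemma sharp_in_B_A:
  assumes A: "positive_op A" and T: "T \<in> B_A A"
  shows "sharp A T \<in> B_A A"
proof -
  note X = bounded_clinear_sharp[OF A T] and T' = B_A_bounded_clinear[OF T]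
  have "cadjoint (sharp A T) (A x) = A (T x)" for x
  proof (rule cinner_ext)
    fix z
    have "cinner z (cadjoint (sharp A T) (A x)) = cinner (A (sharp A T z)) x"
      by (simp add: cinner_cadjoint[OF X, symmetric] positive_op_selfadjoint[OF A])
    also have "\<dots> = cnj (cinner (T x) (A z))"
      by (metis sharp_eq[OF A T] cinner_cadjoint[OF T'] cinner_commute)
    also have "\<dots> = cinner z (A (T x))"
      by (metis cinner_commute positive_op_selfadjoint[OF A])
    finally show "cinner z (cadjoint (sharp A T) (A x)) = cinner z (A (T x))" .
  qed
  then show ?thesis using X by (auto simp: B_A_def)
qed

lemma sharp_scaleC:
  assumes A: "positive_op A" and T: "T \<in> B_A A"
  shows "sharp A (\<lambda>x. c *\<^sub>C T x) = (\<lambda>x. cnj c *\<^sub>C sharp A T x)"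
proof (rule sharp_eqI[OF A])
  note X = bounded_clinear_sharp[OF A T] and T' = B_A_bounded_clinear[OF T]
    and A' = positive_op_bounded_clinear[OF A]
  show "bounded_clinear (\<lambda>x. cnj c *\<^sub>C sharp A T x)"
    using bounded_clinear_lincomb[OF X X, of "cnj c" 0] by (simp add: scaleC_zero_left)
  have "cadjoint (\<lambda>x. c *\<^sub>C T x) = (\<lambda>x. cnj c *\<^sub>C cadjoint T x)"
    using cadjoint_lincomb[OF T' T', of c 0] by (simp add: scaleC_zero_left)
  then show "A \<circ> (\<lambda>x. cnj c *\<^sub>C sharp A T x) = cadjoint (\<lambda>x. c *\<^sub>C T x) \<circ> A"
    by (simp add: fun_eq_iff bounded_clinear_scaleC[OF A'] sharp_eq[OF A T])
  show "range (\<lambda>x. cnj c *\<^sub>C sharp A T x) \<subseteq> closure (range A)"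
    using csubspace_closure[OF csubspace_range[OF A']] sharp_range[OF A T]
    by (auto simp: csubspace_def)
qed

section \<open>The bound for the generalized numerical radius\<close>

lemma Re_A_in_B_A:
  assumes "positive_op A" "T \<in> B_A A"
  shows "Re_A A T \<in> B_A A"
  using B_A_lincomb[OF positive_op_bounded_clinear[OF assms(1)] assms(2) sharp_in_B_A[OF assms],
      of "1/2" "1/2"]
  by (simp add: Re_A_def scaleC_add_right)

lemma Im_A_in_B_A:
  assumes "positive_op A" "T \<in> B_A A"
  shows "Im_A A T \<in> B_A A"
proof -
  have "Im_A A T = (\<lambda>x. (1 / (2 * \<i>)) *\<^sub>C T x + (- 1 / (2 * \<i>)) *\<^sub>C sharp A T x)"
    unfolding Im_A_def
    by (simp add: scaleC_diff_right scaleC_minus_left fun_eq_iff)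
  then show ?thesis
    using B_A_lincomb[OF positive_op_bounded_clinear[OF assms(1)] assms(2) sharp_in_B_A[OF assms]]
    by simp
qed

text \<open>
  With \<open>c = cos \<theta>\<close> and \<open>s = sin \<theta>\<close>, conjugate-linearity of the sharp operation turns the left side into
  \<open>((c + \<i> s) T + (c - \<i> s) T\<^sup>\<sharp>) / 2\<close>, and sorting by \<open>c\<close> and \<open>s\<close> gives the right side.
\<close>

lemma Re_A_rotate:
  assumes "positive_op A" "T \<in> B_A A"
  shows "Re_A A (\<lambda>x. exp (\<i> * complex_of_real \<theta>) *\<^sub>C T x)
    = (\<lambda>x. complex_of_real (cos \<theta>) *\<^sub>C Re_A A T x + complex_of_real (- sin \<theta>) *\<^sub>C Im_A A T x)"
proof
  fix x
  define c s where "c = complex_of_real (cos \<theta>)" and "s = complex_of_real (sin \<theta>)"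
  have e: "exp (\<i> * complex_of_real \<theta>) = c + \<i> * s" "cnj (c + \<i> * s) = c - \<i> * s"
    by (simp_all add: c_def s_def exp_Euler cos_of_real sin_of_real)
  let ?T = "T x" and ?S = "sharp A T x"
  have "c *\<^sub>C Re_A A T x + (- s) *\<^sub>C Im_A A T x
      = (c / 2) *\<^sub>C ?T + (c / 2) *\<^sub>C ?S + ((\<i> * s / 2) *\<^sub>C ?T + (- (\<i> * s / 2)) *\<^sub>C ?S)"
  proof -
    have "(- s) *\<^sub>C Im_A A T x = (\<i> * s / 2) *\<^sub>C (?T + (- 1) *\<^sub>C ?S)"
      unfolding Im_A_def scaleC_scaleC scaleC_minus1
      by (intro arg_cong2[where f = scaleC]) (simp_all add: field_simps)
    then show ?thesis
      by (simp add: Re_A_def scaleC_scaleC scaleC_add_right)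
  qed
  also have "\<dots> = ((c + \<i> * s) / 2) *\<^sub>C ?T + ((c - \<i> * s) / 2) *\<^sub>C ?S"
    using scaleC_add_left[of "c / 2" "\<i> * s / 2" ?T] scaleC_add_left[of "c / 2" "- (\<i> * s / 2)" ?S]
    by (simp add: add_divide_distrib diff_divide_distrib)
  also have "\<dots> = Re_A A (\<lambda>x. (c + \<i> * s) *\<^sub>C T x) x"
    unfolding Re_A_def sharp_scaleC[OF assms] e(2) by (simp add: scaleC_add_right scaleC_scaleC)
  finally show "Re_A A (\<lambda>x. exp (\<i> * complex_of_real \<theta>) *\<^sub>C T x) x
      = complex_of_real (cos \<theta>) *\<^sub>C Re_A A T x + complex_of_real (- sin \<theta>) *\<^sub>C Im_A A T x"
    unfolding e(1) by (simp add: c_def s_def)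
qed

lemma cos_sin_combination_le_sqrt:
  "\<bar>cos \<theta>\<bar> * a + \<bar>sin \<theta>\<bar> * b \<le> sqrt (a\<^sup>2 + b\<^sup>2)" for a b \<theta> :: real
proof (rule real_le_rsqrt)
  \<comment> \<open>Lagrange's identity exhibits the defect in the Cauchy-Schwarz inequality as a square\<close>
  have "a\<^sup>2 + b\<^sup>2 = (\<bar>cos \<theta>\<bar>\<^sup>2 + \<bar>sin \<theta>\<bar>\<^sup>2) * (a\<^sup>2 + b\<^sup>2)" by simp
  also have "\<dots> = (\<bar>cos \<theta>\<bar> * a + \<bar>sin \<theta>\<bar> * b)\<^sup>2 + (\<bar>cos \<theta>\<bar> * b - \<bar>sin \<theta>\<bar> * a)\<^sup>2"
    by algebra
  finally show "(\<bar>cos \<theta>\<bar> * a + \<bar>sin \<theta>\<bar> * b)\<^sup>2 \<le> a\<^sup>2 + b\<^sup>2" by simp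
qed

theorem theorem2p12:
  fixes A T :: "'a::chilbert_space \<Rightarrow> 'a"
    and N :: "('a \<Rightarrow> 'a) \<Rightarrow> real"
  assumes "positive_op A"
    and "A \<noteq> (\<lambda>x. 0)"
    and "seminorm_B_A A N"
    and "T \<in> B_A A"
  shows "gen_numerical_radius A N T \<le> sqrt ((N (Re_A A T))\<^sup>2 + (N (Im_A A T))\<^sup>2)"
  unfolding gen_numerical_radius_def
proof (rule cSUP_least)
  fix \<theta> :: real
  note A = positive_op_bounded_clinear[OF assms(1)]
  note R = Re_A_in_B_A[OF assms(1,4)] and I = Im_A_in_B_A[OF assms(1,4)]
  have scale: "N (\<lambda>x. c *\<^sub>C S x) = cmod c * N S" if "S \<in> B_A A" for c S
    using assms(3) that by (simp add: seminorm_B_A_def)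
  have "N (Re_A A (\<lambda>x. exp (\<i> * complex_of_real \<theta>) *\<^sub>C T x))
      \<le> N (\<lambda>x. complex_of_real (cos \<theta>) *\<^sub>C Re_A A T x)
        + N (\<lambda>x. complex_of_real (- sin \<theta>) *\<^sub>C Im_A A T x)"
    unfolding Re_A_rotate[OF assms(1,4)]
    using assms(3) B_A_scaleC[OF A R] B_A_scaleC[OF A I] by (simp add: seminorm_B_A_def)
  also have "\<dots> = \<bar>cos \<theta>\<bar> * N (Re_A A T) + \<bar>sin \<theta>\<bar> * N (Im_A A T)"
    unfolding scale[OF R] scale[OF I] norm_of_real by simp
  also have "\<dots> \<le> sqrt ((N (Re_A A T))\<^sup>2 + (N (Im_A A T))\<^sup>2)"
    by (rule cos_sin_combination_le_sqrt)
  finally show "N (Re_A A (\<lambda>x. exp (\<i> * complex_of_real \<theta>) *\<^sub>C T x))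
      \<le> sqrt ((N (Re_A A T))\<^sup>2 + (N (Im_A A T))\<^sup>2)" .
qed simp

end
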